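(* Let $n,m$ be integers with $1\le m<n$ and $q$ a prime power, with $n+q\to\infty$. Let $X\subseteq\mathbb{F}_q^n$ be random, containing each element of $\mathbb{F}_q^n$ independently with probability $\theta$. Let $\ell\le q^m$ be an integer with $\ell=\omega((n-m)m\log q)$. Then the event $\Gamma=\Gamma(\theta;\ell)$ that there is an $\ell$-rich $m$-flat with respect to $X$ has sharp threshold $\ell q^{-m}$: for every fixed $\epsilon>0$, $\Pr[\Gamma]\to0$ if $\theta\le(1-\epsilon)\ell q^{-m}$ and $\Pr[\Gamma]\to1$ if $\theta\ge(1+\epsilon)\ell q^{-m}$.
   Context: An $m$-flat in $\mathbb{F}_q^n$ is a translate of an $m$-dimensional linear subspace. An $m$-flat $L$ is $\ell$-rich with respect to $X$ if $|L\cap X|\ge\ell$. *)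

theory Defs
  imports
    "HOL-Probability.Probability"
    "HOL-Library.Landau_Symbols"
    "HOL-Number_Theory.Prime_Powers"
    "HOL-Algebra.AbelCoset"
    "Jordan_Normal_Form.Missing_VectorSpace"
begin

text \<open>
  Asymptotic statements over \<open>\<bbbF>\<^sub>q\<^sup>n\<close> let \<open>q\<close> and \<open>n\<close> vary along a sequence, so the field is an
  HOL-Algebra structure and \<open>F\<^sup>n\<close> is the space of (extensional) functions from \<open>{0, ..., n - 1}\<close>
  to the carrier of \<open>F\<close>.
\<close>

abbreviation coord_space :: "('a, 'r) ring_scheme \<Rightarrow> nat \<Rightarrow> ('a, nat \<Rightarrow> 'a) module" where
  "coord_space F n \<equiv> ring.func_space F {..<n}"

definition is_flat :: "('a, 'r) ring_scheme \<Rightarrow> nat \<Rightarrow> nat \<Rightarrow> (nat \<Rightarrow> 'a) set \<Rightarrow> bool" where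
  "is_flat F n m L \<longleftrightarrow>
     (\<exists>W v. VectorSpace.subspace F W (coord_space F n) \<and>
            vectorspace.dim F (coord_space F n\<lparr>carrier := W\<rparr>) = m \<and>
            v \<in> carrier (coord_space F n) \<and>
            L = v <+\<^bsub>coord_space F n\<^esub> W)"

definition is_rich :: "nat \<Rightarrow> 'v set \<Rightarrow> 'v set \<Rightarrow> bool" where
  "is_rich l X L \<longleftrightarrow> l \<le> card (L \<inter> X)"

text \<open>
  The \<open>\<theta>\<close>-random subset of a finite set \<open>A\<close>, as a distribution on sets. Since
  \<^const>\<open>bernoulli_pmf\<close> clips its parameter, this is only meaningful for \<open>0 \<le> \<theta> \<le> 1\<close>.
\<close>

definition random_subset :: "'v set \<Rightarrow> real \<Rightarrow> 'v set pmf" where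
  "random_subset A \<theta> =
     map_pmf (\<lambda>f. {x \<in> A. f x}) (Pi_pmf A False (\<lambda>_. bernoulli_pmf \<theta>))"

definition rich_flat_event ::
    "('a, 'r) ring_scheme \<Rightarrow> nat \<Rightarrow> nat \<Rightarrow> nat \<Rightarrow> (nat \<Rightarrow> 'a) set set" where
  "rich_flat_event F n m l = {X. \<exists>L. is_flat F n m L \<and> is_rich l X L}"

end

(*
  The number of points of X on one flat is binomial with mean theta q^m, so by Chernoff's inequality it
  deviates from the mean by a constant factor with probability at most exp (-c l). Above the
  threshold a single flat is therefore rich. Below it, a union bound suffices: there are at most
  q^(5 (n-m) m) flats (a subspace is determined by m pivot coordinates and the m (n-m) other entries
  of its reduced basis), and (n-m) m log q = o(l).
*)
theory Submission
  imports Defs "HOL-Algebra.Multiplicative_Group"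
begin

section \<open>Cardinality and dimension of subspaces over a finite field\<close>

text \<open>Coordinates with respect to a basis identify V with the functions from the basis to K. A
  finite basis exists because the finite carrier generates V.\<close>

lemma (in vectorspace) card_carrier_eq_power_dim:
  assumes "finite (carrier K)" "finite (carrier V)"
  shows "card (carrier V) = card (carrier K) ^ dim"
proof -
  have "gen_set (carrier V)"
    by (intro equalityI span_is_subset2 in_own_span) auto
  then have fin_dim
    unfolding fin_dim_def using assms(2) by blast
  then obtain B where B: "finite B" "basis B"
    using finite_basis_exists by blast
  then have BC: "B \<subseteq> carrier V"
    by (simp add: basis_def)
  have uniq: "\<forall>v. v \<in> carrier V \<longrightarrow> (\<exists>!a. a \<in> B \<rightarrow>\<^sub>E carrier K \<and> lincomb a B = v)"
    using basis_criterion[OF B(1) BC] B(2) by blast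
  have closed: "lincomb a B \<in> carrier V" if "a \<in> B \<rightarrow>\<^sub>E carrier K" for a
    using that BC by (intro lincomb_closed) auto
  have "bij_betw (\<lambda>a. lincomb a B) (B \<rightarrow>\<^sub>E carrier K) (carrier V)"
    unfolding bij_betw_def
  proof
    show "inj_on (\<lambda>a. lincomb a B) (B \<rightarrow>\<^sub>E carrier K)"
      using uniq closed by (intro inj_onI) metis
    show "(\<lambda>a. lincomb a B) ` (B \<rightarrow>\<^sub>E carrier K) = carrier V"
      using uniq closed by blast
  qed
  then show ?thesis
    using bij_betw_same_card card_funcsetE[OF B(1)] dim_basis[OF B] by metis
qed

context Ring.field
begin

lemma func_space_vectorspace: "vectorspace R (func_space S)"
  unfolding vectorspace_def by (intro conjI func_space_is_module field_axioms)

text \<open>Pointwise form of the module-theoretic definition, so that later closure arguments deal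
  with explicit functions only.\<close>

lemma subspace_func_space_iff:
  "VectorSpace.subspace R W (func_space I) \<longleftrightarrow>
     W \<subseteq> I \<rightarrow>\<^sub>E carrier R \<and> (\<lambda>_\<in>I. \<zero>) \<in> W \<and>
     (\<forall>v\<in>W. \<forall>w\<in>W. (\<lambda>i\<in>I. v i \<oplus> w i) \<in> W) \<and>
     (\<forall>c\<in>carrier R. \<forall>w\<in>W. (\<lambda>i\<in>I. c \<otimes> w i) \<in> W)"
  using func_space_vectorspace[of I] func_space_is_module[of I]
  by (auto simp: VectorSpace.subspace_def submodule_def func_space_def)

lemma subspace_func_space_subset:
  "VectorSpace.subspace R W (func_space I) \<Longrightarrow> W \<subseteq> I \<rightarrow>\<^sub>E carrier R"
  by (simp add: subspace_func_space_iff)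

lemma subspace_func_space_Int:
  assumes "VectorSpace.subspace R U (func_space I)" "VectorSpace.subspace R W (func_space I)"
  shows "VectorSpace.subspace R (U \<inter> W) (func_space I)"
  using assms unfolding subspace_func_space_iff by blast

text \<open>Trades dimension for cardinality: below, an m-dimensional subspace is recognised by its
  q^m elements.\<close>

lemma card_subspace_func_space:
  assumes "VectorSpace.subspace R W (func_space I)" "finite (carrier R)" "finite I"
  shows "finite W" "card W = card (carrier R) ^ vectorspace.dim R (func_space I\<lparr>carrier := W\<rparr>)"
proof -
  interpret V: vectorspace R "func_space I"
    by (rule func_space_vectorspace)
  interpret W: vectorspace R "func_space I\<lparr>carrier := W\<rparr>"
    by (rule V.subspace_is_vs[OF assms(1)])
  have "W \<subseteq> I \<rightarrow>\<^sub>E carrier R"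
    by (rule subspace_func_space_subset[OF assms(1)])
  then show "finite W"
    using assms by (meson finite_PiE finite_subset)
  then show "card W = card (carrier R) ^ vectorspace.dim R (func_space I\<lparr>carrier := W\<rparr>)"
    using W.card_carrier_eq_power_dim assms(2) by simp
qed

section \<open>Pivot coordinates and the number of subspaces\<close>

text \<open>The witness is the linear combination of the vectors from \<open>unit\<close> with
  coefficients \<open>c i\<close>, built up one coordinate at a time.\<close>

lemma restrict_subspace_onto:
  assumes "VectorSpace.subspace R W (func_space I)" "finite S" "S \<subseteq> I"
    and unit: "\<And>i. i \<in> S \<Longrightarrow> \<exists>w\<in>W. \<forall>j\<in>S. w j = (if j = i then \<one> else \<zero>)"
    and c: "c \<in> S \<rightarrow> carrier R"
  shows "\<exists>w\<in>W. \<forall>j\<in>S. w j = c j"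
proof -
  note W = assms(1)[unfolded subspace_func_space_iff]
  have add: "(\<lambda>i\<in>I. v i \<oplus> w i) \<in> W" if "v \<in> W" "w \<in> W" for v w
    using W that by simp
  \<comment> \<open>Prescribing zero on \<open>S - T\<close> makes the induction work: adding
    \<open>c i\<close> times the i-th unit vector then changes position \<open>i\<close>
    only.\<close>
  have "\<exists>w\<in>W. \<forall>j\<in>S. w j = (if j \<in> T then c j else \<zero>)" if "finite T" "T \<subseteq> S" for T
    using that
  proof (induction T rule: finite_induct)
    case empty
    show ?case
      using W assms(3) by (intro bexI[of _ "\<lambda>_\<in>I. \<zero>"]) auto
  next
    case (insert i T)
    then obtain w where w: "w \<in> W" "\<And>j. j \<in> S \<Longrightarrow> w j = (if j \<in> T then c j else \<zero>)"
      by auto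
    obtain b where b: "b \<in> W" "\<And>j. j \<in> S \<Longrightarrow> b j = (if j = i then \<one> else \<zero>)"
      using unit[of i] insert.prems by auto
    let ?u = "\<lambda>j\<in>I. (\<lambda>j\<in>I. c i \<otimes> b j) j \<oplus> w j"
    have ci: "c i \<in> carrier R"
      using c insert by auto
    have "(\<lambda>j\<in>I. c i \<otimes> b j) \<in> W"
      using W ci b(1) by simp
    then have "?u \<in> W"
      by (rule add[OF _ w(1)])
    moreover have "?u j = (if j \<in> insert i T then c j else \<zero>)" if "j \<in> S" for j
      using that assms(3) w(2)[OF that] b(2)[OF that] ci c insert.hyps by (auto simp: Pi_iff subset_iff)
    ultimately show ?case
      by blast
  qed
  from this[OF assms(2) subset_refl] show ?thesis
    by auto
qed

text \<open>Take S of least cardinality such that a vector of W vanishing on S is zero. By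
  linearity, restriction to S is injective. By minimality, each \<open>i\<close> in S has a nonzero
  vector of W that vanishes on the rest of S; rescaling it gives the unit vector.\<close>

lemma ex_pivot_set:
  assumes "VectorSpace.subspace R W (func_space I)" "finite I"
  obtains S where "S \<subseteq> I" "inj_on (\<lambda>w. restrict w S) W"
    and "\<And>i. i \<in> S \<Longrightarrow> \<exists>w\<in>W. \<forall>j\<in>S. w j = (if j = i then \<one> else \<zero>)"
proof -
  note W = assms(1)[unfolded subspace_func_space_iff]
  define P where "P = (\<lambda>S. S \<subseteq> I \<and> (\<forall>w\<in>W. (\<forall>i\<in>S. w i = \<zero>) \<longrightarrow> (\<forall>i\<in>I. w i = \<zero>)))"
  have "P I"
    by (auto simp: P_def)
  then obtain S where S: "P S" and min: "\<And>T. P T \<Longrightarrow> card S \<le> card T"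
    using ex_has_least_nat[of P I card] by blast
  have SI: "S \<subseteq> I" and ker: "\<And>w. w \<in> W \<Longrightarrow> \<forall>i\<in>S. w i = \<zero> \<Longrightarrow> \<forall>i\<in>I. w i = \<zero>"
    using S by (auto simp: P_def)
  have carr: "w i \<in> carrier R" if "w \<in> W" "i \<in> I" for w i
    using W that by auto
  show thesis
  proof (rule that[OF SI])
    show "inj_on (\<lambda>w. restrict w S) W"
    proof (rule inj_onI)
      fix v w assume vw: "v \<in> W" "w \<in> W" "restrict v S = restrict w S"
      have eq: "v i = w i" if "i \<in> S" for i
        using that vw(3) by (metis restrict_apply')
      \<comment> \<open>The difference of \<open>v\<close> and \<open>w\<close>, written with the
        two operations under which W is closed.\<close>
      define u where "u = (\<lambda>i\<in>I. v i \<oplus> (\<lambda>i\<in>I. (\<ominus> \<one>) \<otimes> w i) i)"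
      have "u \<in> W"
        unfolding u_def using W vw by blast
      moreover have u: "u i = v i \<ominus> w i" if "i \<in> I" for i
        using that carr[OF vw(2) that] by (simp add: u_def minus_eq l_minus)
      ultimately have "\<forall>i\<in>I. u i = \<zero>"
        using eq carr vw SI by (intro ker) auto
      then have "v i = w i" if "i \<in> I" for i
        using that u carr vw by simp
      then show "v = w"
        using W vw by (intro PiE_ext[of v I "\<lambda>_. carrier R" w]) auto
    qed
  next
    fix i assume i: "i \<in> S"
    have "card (S - {i}) < card S"
      using i SI assms(2) by (meson card_Diff1_less finite_subset)
    then have "\<not> P (S - {i})"
      using min by (meson leD)
    then obtain w where w: "w \<in> W" "\<forall>j\<in>S - {i}. w j = \<zero>" "\<not> (\<forall>j\<in>I. w j = \<zero>)"
      unfolding P_def using SI by blast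
    \<comment> \<open>Otherwise \<open>w\<close> would vanish on all of S, hence on I.\<close>
    have nz: "w i \<noteq> \<zero>"
      using w ker by blast
    have wi: "w i \<in> Units R"
      using nz carr[OF w(1)] i SI field_Units by auto
    let ?u = "\<lambda>j\<in>I. inv (w i) \<otimes> w j"
    have "?u \<in> W"
      using W w(1) wi by blast
    moreover have "?u j = (if j = i then \<one> else \<zero>)" if "j \<in> S" for j
      using that w wi SI by auto
    ultimately show "\<exists>w\<in>W. \<forall>j\<in>S. w j = (if j = i then \<one> else \<zero>)"
      by blast
  qed
qed

text \<open>A subspace is determined by a set of pivot coordinates together with the remaining entries
  of its reduced basis.\<close>

lemma card_subspaces_func_space_le:
  fixes m :: nat
  assumes "finite (carrier R)" "finite I"
  defines "\<W> \<equiv> {W. VectorSpace.subspace R W (func_space I) \<and> card W = card (carrier R) ^ m}"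
  shows "finite \<W>" "card \<W> \<le> (card I choose m) * card (carrier R) ^ (m * (card I - m))"
proof -
  define q where "q = card (carrier R)"
  have "card {\<zero>, \<one>} \<le> q"
    unfolding q_def using assms by (intro card_mono) auto
  then have q: "q \<ge> 2"
    by (simp add: one_not_zero[symmetric])
  \<comment> \<open>A pivot set S together with the non-pivot entries: row index in S, column index
    in \<open>I - S\<close>.\<close>
  define code where "code = (SIGMA S:{S. S \<subseteq> I \<and> card S = m}. S \<times> (I - S) \<rightarrow>\<^sub>E carrier R)"
  \<comment> \<open>Row \<open>i\<close> of the reduced basis, rebuilt from its code.\<close>
  define vec where
    "vec = (\<lambda>S M i. \<lambda>j\<in>I. if j \<in> S then (if j = i then \<one> else \<zero>) else M (i, j))"
  \<comment> \<open>Injectivity of restriction to S belongs to the relation because decoding relies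
    on it.\<close>
  define P where "P = (\<lambda>W (S, M). S \<subseteq> I \<and> inj_on (\<lambda>w. restrict w S) W \<and> (\<forall>i\<in>S. vec S M i \<in> W))"
  have "\<exists>p\<in>code. P W p" if "W \<in> \<W>" for W
  proof -
    have sub: "VectorSpace.subspace R W (func_space I)" and card: "card W = q ^ m"
      using that by (auto simp: \<W>_def q_def)
    have WI: "W \<subseteq> I \<rightarrow>\<^sub>E carrier R"
      by (rule subspace_func_space_subset[OF sub])
    obtain S where S: "S \<subseteq> I" "inj_on (\<lambda>w. restrict w S) W"
      "\<And>i. i \<in> S \<Longrightarrow> \<exists>w\<in>W. \<forall>j\<in>S. w j = (if j = i then \<one> else \<zero>)"
      using ex_pivot_set[OF sub assms(2)] by blast
    have finS: "finite S"
      using S(1) assms(2) finite_subset by blast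
    \<comment> \<open>Restriction to S is thus a bijection from W onto all functions on S, and
      counting both sides forces \<open>card S = m\<close>.\<close>
    have "(\<lambda>w. restrict w S) ` W = S \<rightarrow>\<^sub>E carrier R"
    proof (intro equalityI subsetI)
      fix c assume c: "c \<in> S \<rightarrow>\<^sub>E carrier R"
      then obtain w where "w \<in> W" "\<forall>j\<in>S. w j = c j"
        using restrict_subspace_onto[OF sub finS S(1) S(3), of c] by auto
      moreover from this have "c = restrict w S"
        using c by (intro extensionalityI[of _ S]) (auto simp: PiE_iff)
      ultimately show "c \<in> (\<lambda>w. restrict w S) ` W"
        by blast
    qed (use WI S(1) in \<open>auto simp: PiE_iff subset_iff\<close>)
    then have "q ^ m = q ^ card S"
      using card_image[OF S(2)] card card_funcsetE[OF finS, of "carrier R"] by (simp add: q_def)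
    then have "card S = m"
      using q by simp
    obtain b where b: "\<And>i. i \<in> S \<Longrightarrow> b i \<in> W \<and> (\<forall>j\<in>S. b i j = (if j = i then \<one> else \<zero>))"
      using S(3) by metis
    define M where "M = (\<lambda>(i, j)\<in>S \<times> (I - S). b i j)"
    have "vec S M i = b i" if "i \<in> S" for i
      using that b[OF that] WI
      by (intro PiE_ext[of _ I "\<lambda>_. UNIV"]) (auto simp: vec_def M_def PiE_iff)
    then have "P W (S, M)"
      using S b by (simp add: P_def)
    moreover have "(S, M) \<in> code"
      using S(1) \<open>card S = m\<close> b WI by (fastforce simp: code_def M_def)
    ultimately show ?thesis
      by blast
  qed
  then obtain f where f: "\<And>W. W \<in> \<W> \<Longrightarrow> f W \<in> code \<and> P W (f W)"
    by metis
  \<comment> \<open>If the codes agree, the rebuilt rows lie in \<open>W \<inter> W'\<close>, which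
    therefore takes all values on S. So \<open>w\<close> agrees on S with some \<open>u\<close> in
    the intersection, and injectivity on W gives \<open>w = u\<close>.\<close>
  have sub: "W \<subseteq> W'" if "W \<in> \<W>" "W' \<in> \<W>" "f W = f W'" for W W'
  proof
    fix w assume w: "w \<in> W"
    obtain S M where SM: "f W = (S, M)"
      by force
    have S: "S \<subseteq> I" "inj_on (\<lambda>w. restrict w S) W" "\<And>i. i \<in> S \<Longrightarrow> vec S M i \<in> W \<inter> W'"
      using f[OF that(1)] f[OF that(2)] SM that(3) by (auto simp: P_def)
    have U: "VectorSpace.subspace R (W \<inter> W') (func_space I)"
      using that by (intro subspace_func_space_Int) (auto simp: \<W>_def)
    have "\<exists>u\<in>W \<inter> W'. \<forall>j\<in>S. u j = w j"
    proof (rule restrict_subspace_onto[OF U])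
      show "finite S"
        using S(1) assms(2) finite_subset by blast
      show "\<exists>u\<in>W \<inter> W'. \<forall>j\<in>S. u j = (if j = i then \<one> else \<zero>)" if "i \<in> S" for i
        using that S by (intro bexI[of _ "vec S M i"]) (auto simp: vec_def)
      show "w \<in> S \<rightarrow> carrier R"
        using w S(1) \<open>W \<in> \<W>\<close> by (auto simp: \<W>_def subspace_func_space_iff)
    qed (rule S(1))
    then obtain u where u: "u \<in> W" "u \<in> W'" "\<forall>j\<in>S. u j = w j"
      by blast
    then have "restrict u S = restrict w S"
      by auto
    then show "w \<in> W'"
      using S(2) u w by (metis inj_onD)
  qed
  have inj: "inj_on f \<W>"
    using sub by (intro inj_onI equalityI) auto
  have img: "f ` \<W> \<subseteq> code"
    using f by blast
  have fin: "finite code"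
    unfolding code_def using assms(1,2) by (intro finite_SigmaI finite_PiE) (auto intro: finite_subset)
  show "finite \<W>"
    using inj img fin by (metis finite_imageD finite_subset)
  have cardM: "card (S \<times> (I - S) \<rightarrow>\<^sub>E carrier R) = q ^ (m * (card I - m))"
    if "S \<subseteq> I" "card S = m" for S
    using that assms(2) finite_subset[OF that(1) assms(2)]
    by (simp add: card_funcsetE card_cartesian_product card_Diff_subset q_def)
  have "card \<W> \<le> card code"
    using inj img fin by (metis card_inj_on_le)
  also have "card code = (\<Sum>S\<in>{S. S \<subseteq> I \<and> card S = m}. card (S \<times> (I - S) \<rightarrow>\<^sub>E carrier R))"
    unfolding code_def using assms(1,2)
    by (intro card_SigmaI) (auto intro!: finite_PiE intro: finite_subset)
  also have "\<dots> = (card I choose m) * q ^ (m * (card I - m))"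
    using cardM n_subsets[OF assms(2), of m] by simp
  finally show "card \<W> \<le> (card I choose m) * card (carrier R) ^ (m * (card I - m))"
    by (simp add: q_def)
qed

section \<open>Size, number and existence of flats\<close>

lemma card_flat:
  assumes "is_flat R n m L" "finite (carrier R)"
  shows "L \<subseteq> carrier (coord_space R n)" "card L = card (carrier R) ^ m"
proof -
  interpret V: vectorspace R "coord_space R n"
    by (rule func_space_vectorspace)
  obtain W v where W: "VectorSpace.subspace R W (coord_space R n)"
      "vectorspace.dim R (coord_space R n\<lparr>carrier := W\<rparr>) = m"
      and v: "v \<in> carrier (coord_space R n)" and L: "L = v <+\<^bsub>coord_space R n\<^esub> W"
    using assms(1) unfolding is_flat_def by blast
  have WV: "W \<subseteq> carrier (coord_space R n)"
    using W(1) by (simp add: VectorSpace.subspace_def submodule_def)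
  have L': "L = (\<lambda>w. v \<oplus>\<^bsub>coord_space R n\<^esub> w) ` W"
    unfolding L a_l_coset_def' by blast
  show "L \<subseteq> carrier (coord_space R n)"
    unfolding L' using WV v by auto
  have "inj_on (\<lambda>w. v \<oplus>\<^bsub>coord_space R n\<^esub> w) W"
    using WV v by (intro inj_onI) (auto simp: subset_iff)
  then show "card L = card (carrier R) ^ m"
    unfolding L' using card_subspace_func_space[OF W(1) assms(2)] W(2) by (simp add: card_image)
qed

text \<open>A flat is given by a base point and a direction space. Each flat is counted once for
  every one of its points, a loss that the final bound can afford.\<close>

lemma card_flats_le:
  assumes "finite (carrier R)"
  shows "finite {L. is_flat R n m L}"
    "card {L. is_flat R n m L} \<le>
       card (carrier R) ^ n * ((n choose m) * card (carrier R) ^ (m * (n - m)))"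
proof -
  define \<W> where
    "\<W> = {W. VectorSpace.subspace R W (coord_space R n) \<and> card W = card (carrier R) ^ m}"
  have \<W>: "finite \<W>" "card \<W> \<le> (n choose m) * card (carrier R) ^ (m * (n - m))"
    using card_subspaces_func_space_le[OF assms, of "{..<n}" m] by (simp_all add: \<W>_def)
  have V: "carrier (coord_space R n) = {..<n} \<rightarrow>\<^sub>E carrier R"
    by (simp add: func_space_def)
  have finV: "finite (carrier (coord_space R n))"
    unfolding V using assms by (intro finite_PiE) auto
  have sub: "{L. is_flat R n m L} \<subseteq>
      (\<lambda>(v, W). v <+\<^bsub>coord_space R n\<^esub> W) ` (carrier (coord_space R n) \<times> \<W>)"
    unfolding is_flat_def \<W>_def
    using card_subspace_func_space(2)[OF _ assms, of _ "{..<n}"] by fastforce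
  show "finite {L. is_flat R n m L}"
    using sub finV \<W>(1) by (meson finite_SigmaI finite_imageI finite_subset)
  have "card {L. is_flat R n m L} \<le> card (carrier (coord_space R n) \<times> \<W>)"
    using sub finV \<W>(1) by (meson surj_card_le finite_SigmaI)
  also have "\<dots> = card (carrier R) ^ n * card \<W>"
    by (simp add: card_cartesian_product V card_funcsetE)
  finally show "card {L. is_flat R n m L} \<le>
       card (carrier R) ^ n * ((n choose m) * card (carrier R) ^ (m * (n - m)))"
    using \<W>(2) by (simp add: le_trans[OF _ mult_le_mono2])
qed

text \<open>Base points and binomial coefficient contribute at most \<open>q ^ n\<close> each. Since
  \<open>n \<le> 2 * ((n - m) * m)\<close>, they cost 4 of the 5 units of \<open>(n - m) * m\<close>
  in the exponent; the entries of the reduced basis cost the fifth.\<close>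

lemma card_flats_le_power:
  assumes "finite (carrier R)" "1 \<le> m" "m < n"
  shows "card {L. is_flat R n m L} \<le> card (carrier R) ^ (5 * ((n - m) * m))"
proof -
  define q where "q = card (carrier R)"
  have "card {\<zero>, \<one>} \<le> q"
    unfolding q_def using assms by (intro card_mono) auto
  then have q: "q \<ge> 2"
    by (simp add: one_not_zero[symmetric])
  obtain a where a: "n = m + Suc a"
    using less_imp_Suc_add assms(3) by (metis add_Suc_right)
  obtain b where b: "m = Suc b"
    using assms(2) not0_implies_Suc by fastforce
  have n: "n \<le> 2 * ((n - m) * m)"
    by (simp add: a b)
  have "n choose m \<le> 2 ^ n"
    by (rule binomial_le_pow2)
  also have "\<dots> \<le> q ^ n"
    using q by (rule power_mono) simp
  finally have "card {L. is_flat R n m L} \<le> q ^ n * (q ^ n * q ^ (m * (n - m)))"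
    using card_flats_le(2)[OF assms(1), of n m] unfolding q_def[symmetric]
    by (meson le_trans mult_le_mono1 mult_le_mono2)
  also have "\<dots> = q ^ (2 * n + (n - m) * m)"
    by (simp add: power_add mult_2 mult.assoc mult.commute[of m "n - m"])
  also have "\<dots> \<le> q ^ (5 * ((n - m) * m))"
    using q n by (intro power_increasing) (auto simp: mult.commute)
  finally show ?thesis
    by (simp add: q_def)
qed

lemma ex_flat:
  assumes "finite (carrier R)" "m \<le> n"
  shows "\<exists>L. is_flat R n m L"
proof -
  interpret V: vectorspace R "coord_space R n"
    by (rule func_space_vectorspace)
  define q where "q = card (carrier R)"
  have "card {\<zero>, \<one>} \<le> q"
    unfolding q_def using assms by (intro card_mono) auto
  then have q: "q \<ge> 2"
    by (simp add: one_not_zero[symmetric])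
  \<comment> \<open>The coordinate subspace spanned by the first \<open>m\<close> unit vectors; its
    dimension is read off from its cardinality.\<close>
  define W where "W = {w \<in> {..<n} \<rightarrow>\<^sub>E carrier R. \<forall>i\<in>{m..<n}. w i = \<zero>}"
  have sub: "VectorSpace.subspace R W (coord_space R n)"
    unfolding subspace_func_space_iff W_def by auto
  have "bij_betw (\<lambda>w. restrict w {..<m}) W ({..<m} \<rightarrow>\<^sub>E carrier R)"
    by (rule bij_betwI[where g = "\<lambda>w. \<lambda>i\<in>{..<n}. if i < m then w i else \<zero>"])
       (use assms(2) in \<open>auto simp: W_def PiE_iff extensional_def fun_eq_iff restrict_def\<close>)
  then have "card W = q ^ m"
    by (simp add: bij_betw_same_card card_funcsetE q_def)
  then have "vectorspace.dim R (coord_space R n\<lparr>carrier := W\<rparr>) = m"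
    using card_subspace_func_space(2)[OF sub assms(1)] q by (simp add: q_def[symmetric])
  then show ?thesis
    unfolding is_flat_def using sub V.M.zero_closed by (intro exI conjI) auto
qed

end

section \<open>Generating function and Chernoff bound\<close>

text \<open>The power is a product of independent factors, one per point of A. A point of L
  contributes 1 - \<theta> + w \<theta> on average, any other point contributes 1.\<close>

lemma expectation_power_card_random_subset:
  fixes w :: real
  assumes "finite A" "L \<subseteq> A" "0 \<le> \<theta>" "\<theta> \<le> 1" "0 \<le> w"
  shows "measure_pmf.expectation (random_subset A \<theta>) (\<lambda>X. w ^ card (L \<inter> X)) =
           (1 + (w - 1) * \<theta>) ^ card L"
proof -
  define g where "g = (\<lambda>x b. if x \<in> L \<and> b then w else 1)"
  have "w ^ card (L \<inter> {x \<in> A. f x}) = (\<Prod>x\<in>A. g x (f x))" for f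
  proof -
    have "(\<Prod>x\<in>A. g x (f x)) = (\<Prod>x\<in>{x \<in> A. x \<in> L \<and> f x}. w)"
      unfolding g_def by (rule prod.inter_filter[OF assms(1), symmetric])
    also have "{x \<in> A. x \<in> L \<and> f x} = L \<inter> {x \<in> A. f x}"
      by auto
    finally show ?thesis
      by simp
  qed
  then have "measure_pmf.expectation (random_subset A \<theta>) (\<lambda>X. w ^ card (L \<inter> X)) =
      measure_pmf.expectation (Pi_pmf A False (\<lambda>_. bernoulli_pmf \<theta>)) (\<lambda>f. \<Prod>x\<in>A. g x (f x))"
    by (simp add: random_subset_def)
  also have "\<dots> = (\<Prod>x\<in>A. measure_pmf.expectation (bernoulli_pmf \<theta>) (g x))"
    using assms(1,5)
    by (intro expectation_prod_Pi_pmf integrable_measure_pmf_finite) (auto simp: g_def)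
  also have "\<dots> = (\<Prod>x\<in>A. if x \<in> L then 1 + (w - 1) * \<theta> else 1)"
    using assms(3,4) by (intro prod.cong) (auto simp: g_def algebra_simps)
  also have "\<dots> = (1 + (w - 1) * \<theta>) ^ card {x \<in> A. x \<in> L}"
    using prod.inter_filter[OF assms(1), of "\<lambda>_. 1 + (w - 1) * \<theta>" "\<lambda>x. x \<in> L"] by simp
  also have "{x \<in> A. x \<in> L} = L"
    using assms(2) by auto
  finally show ?thesis .
qed

text \<open>The sign of \<open>\<delta>\<close> decides which tail is bounded: the event is \<open>card (L \<inter> X) \<le> l\<close> for
  \<open>\<delta> > 0\<close> and \<open>l \<le> card (L \<inter> X)\<close> for \<open>-1 < \<delta> < 0\<close>.\<close>

lemma random_subset_chernoff:
  fixes \<delta> :: real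
  assumes "finite A" "L \<subseteq> A" "0 \<le> \<theta>" "\<theta> \<le> 1" "-1 < \<delta>"
    and "(1 + \<delta>) * \<delta> * real l \<le> \<delta> * \<theta> * real (card L)"
  shows "measure_pmf.prob (random_subset A \<theta>) {X. (1 + \<delta>) ^ card (L \<inter> X) \<le> (1 + \<delta>) ^ l}
           \<le> exp (- (\<delta> - ln (1 + \<delta>)) * real l)"
proof -
  let ?p = "random_subset A \<theta>"
  \<comment> \<open>With mean \<mu> = (1 + \<delta>) l, this \<open>w\<close> minimises w^(-l)
    exp((w - 1) \<mu>), for either sign of \<delta>.\<close>
  let ?w = "1 / (1 + \<delta>)"
  have fin: "finite (set_pmf ?p)"
    by (rule finite_subset[of _ "Pow A"]) (use assms(1) in \<open>auto simp: random_subset_def\<close>)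
  have "measure_pmf.prob ?p {X. (1 + \<delta>) ^ card (L \<inter> X) \<le> (1 + \<delta>) ^ l} =
      measure_pmf.expectation ?p (indicator {X. (1 + \<delta>) ^ card (L \<inter> X) \<le> (1 + \<delta>) ^ l})"
    by simp
  \<comment> \<open>Markov's inequality: on the event the new integrand is at least 1, elsewhere it
    is nonnegative.\<close>
  also have "\<dots> \<le> measure_pmf.expectation ?p (\<lambda>X. (1 + \<delta>) ^ l * ?w ^ card (L \<inter> X))"
    using assms(5)
    by (intro integral_mono integrable_measure_pmf_finite fin)
       (auto simp: indicator_def power_one_over field_simps)
  also have "\<dots> = (1 + \<delta>) ^ l * (1 + (?w - 1) * \<theta>) ^ card L"
    using assms(5) expectation_power_card_random_subset[OF assms(1-4), of ?w] by simp
  also have "\<dots> \<le> (1 + \<delta>) ^ l * exp (- \<delta> * real l)"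
  proof (rule mult_left_mono)
    \<comment> \<open>A nonnegative base is needed to raise 1 + x \<le> exp x to a power.\<close>
    have "0 \<le> 1 - \<theta> + ?w * \<theta>"
      using assms(3-5) by simp
    then have "0 \<le> 1 + (?w - 1) * \<theta>"
      by (simp add: algebra_simps)
    then have "(1 + (?w - 1) * \<theta>) ^ card L \<le> exp ((?w - 1) * \<theta>) ^ card L"
      by (intro power_mono exp_ge_add_one_self)
    also have "\<dots> = exp (- (\<delta> * \<theta> * real (card L) / (1 + \<delta>)))"
      using assms(5) by (simp add: exp_of_nat_mult[symmetric] field_simps)
    also have "\<dots> \<le> exp (- \<delta> * real l)"
      using assms(5,6) by (simp add: field_simps)
    finally show "(1 + (?w - 1) * \<theta>) ^ card L \<le> exp (- \<delta> * real l)" .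
  qed (use assms(5) in simp)
  also have "\<dots> = exp (real l * ln (1 + \<delta>)) * exp (- \<delta> * real l)"
    using assms(5) by (simp add: exp_of_nat_mult)
  also have "\<dots> = exp (- (\<delta> - ln (1 + \<delta>)) * real l)"
    by (simp add: exp_add[symmetric] algebra_simps)
  finally show ?thesis .
qed

section \<open>Probability bounds over one fixed field\<close>

text \<open>Chernoff with \<delta> = -\<epsilon> for each single flat, then a union bound over all
  flats. The condition \<epsilon> < 1 keeps 1 + \<delta> positive.\<close>

lemma (in Ring.field) prob_rich_flat_le:
  fixes \<epsilon> :: real
  assumes "finite (carrier R)" "1 \<le> m" "m < n" "0 \<le> \<theta>" "\<theta> \<le> 1" "0 < \<epsilon>" "\<epsilon> < 1"
    and "\<theta> \<le> (1 - \<epsilon>) * (real l / real (card (carrier R)) ^ m)"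
  shows "measure_pmf.prob (random_subset (carrier (coord_space R n)) \<theta>) (rich_flat_event R n m l)
           \<le> real (card (carrier R)) ^ (5 * ((n - m) * m)) * exp (- (- \<epsilon> - ln (1 - \<epsilon>)) * real l)"
proof -
  define q where "q = card (carrier R)"
  have q: "q > 0"
    unfolding q_def using assms(1) zero_closed by (auto simp: card_gt_0_iff)
  let ?V = "carrier (coord_space R n)"
  have fin: "finite ?V"
    unfolding func_space_def using assms(1) by (simp add: finite_PiE)
  have single: "measure_pmf.prob (random_subset ?V \<theta>) {X. l \<le> card (L \<inter> X)}
      \<le> exp (- (- \<epsilon> - ln (1 - \<epsilon>)) * real l)" if "is_flat R n m L" for L
  proof -
    have L: "L \<subseteq> ?V" "card L = q ^ m"
      using card_flat[OF that assms(1)] by (simp_all add: q_def)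
    have "\<theta> * q ^ m \<le> (1 - \<epsilon>) * l"
      using assms(8) q by (simp add: q_def[symmetric] field_simps)
    then have "\<epsilon> * (\<theta> * real q ^ m) \<le> \<epsilon> * ((1 - \<epsilon>) * l)"
      using assms(6) by (intro mult_left_mono) auto
    then have "(1 + - \<epsilon>) * - \<epsilon> * real l \<le> - \<epsilon> * \<theta> * real (card L)"
      using L(2) by (simp add: algebra_simps)
    from random_subset_chernoff[OF fin L(1) assms(4,5) _ this]
    have "measure_pmf.prob (random_subset ?V \<theta>) {X. (1 - \<epsilon>) ^ card (L \<inter> X) \<le> (1 - \<epsilon>) ^ l}
        \<le> exp (- (- \<epsilon> - ln (1 - \<epsilon>)) * real l)"
      using assms(7) by simp
    \<comment> \<open>Powers of a base below 1 decrease, so the Chernoff event contains the upper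
      tail.\<close>
    moreover have "measure_pmf.prob (random_subset ?V \<theta>) {X. l \<le> card (L \<inter> X)} \<le>
        measure_pmf.prob (random_subset ?V \<theta>) {X. (1 - \<epsilon>) ^ card (L \<inter> X) \<le> (1 - \<epsilon>) ^ l}"
      using assms(6,7) by (intro measure_pmf.finite_measure_mono) (auto intro: power_decreasing)
    ultimately show ?thesis
      by linarith
  qed
  have "rich_flat_event R n m l = (\<Union>L\<in>{L. is_flat R n m L}. {X. l \<le> card (L \<inter> X)})"
    by (auto simp: rich_flat_event_def is_rich_def)
  then have "measure_pmf.prob (random_subset ?V \<theta>) (rich_flat_event R n m l) \<le>
      (\<Sum>L | is_flat R n m L. measure_pmf.prob (random_subset ?V \<theta>) {X. l \<le> card (L \<inter> X)})"
    using card_flats_le(1)[OF assms(1)] by (simp add: measure_UNION_le)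
  also have "\<dots> \<le> card {L. is_flat R n m L} * exp (- (- \<epsilon> - ln (1 - \<epsilon>)) * real l)"
    using single by (intro sum_bounded_above) simp
  also have "\<dots> \<le> real q ^ (5 * ((n - m) * m)) * exp (- (- \<epsilon> - ln (1 - \<epsilon>)) * real l)"
    using card_flats_le_power[OF assms(1-3)]
    by (intro mult_right_mono) (simp_all add: q_def flip: of_nat_power)
  finally show ?thesis
    by (simp add: q_def)
qed

text \<open>Fix one flat. If no flat is rich, this one is not, and Chernoff with \<delta> =
  \<epsilon> bounds that lower tail.\<close>

lemma (in Ring.field) prob_rich_flat_ge:
  fixes \<epsilon> :: real
  assumes "finite (carrier R)" "m \<le> n" "0 \<le> \<theta>" "\<theta> \<le> 1" "0 < \<epsilon>"
    and "(1 + \<epsilon>) * (real l / real (card (carrier R)) ^ m) \<le> \<theta>"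
  shows "1 - exp (- (\<epsilon> - ln (1 + \<epsilon>)) * real l)
     \<le> measure_pmf.prob (random_subset (carrier (coord_space R n)) \<theta>) (rich_flat_event R n m l)"
proof -
  define q where "q = card (carrier R)"
  have q: "q > 0"
    unfolding q_def using assms(1) zero_closed by (auto simp: card_gt_0_iff)
  let ?V = "carrier (coord_space R n)"
  let ?p = "random_subset ?V \<theta>"
  have fin: "finite ?V"
    unfolding func_space_def using assms(1) by (simp add: finite_PiE)
  obtain L where flat: "is_flat R n m L"
    using ex_flat[OF assms(1,2)] by blast
  have L: "L \<subseteq> ?V" "card L = q ^ m"
    using card_flat[OF flat assms(1)] by (simp_all add: q_def)
  have "(1 + \<epsilon>) * l \<le> \<theta> * q ^ m"
    using assms(6) q by (simp add: q_def[symmetric] field_simps)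
  then have "\<epsilon> * ((1 + \<epsilon>) * l) \<le> \<epsilon> * (\<theta> * real q ^ m)"
    using assms(5) by (intro mult_left_mono) auto
  then have "(1 + \<epsilon>) * \<epsilon> * real l \<le> \<epsilon> * \<theta> * real (card L)"
    using L(2) by (simp add: algebra_simps)
  from random_subset_chernoff[OF fin L(1) assms(3,4) _ this]
  have "measure_pmf.prob ?p {X. (1 + \<epsilon>) ^ card (L \<inter> X) \<le> (1 + \<epsilon>) ^ l}
      \<le> exp (- (\<epsilon> - ln (1 + \<epsilon>)) * real l)"
    using assms(5) by simp
  moreover have "measure_pmf.prob ?p (- rich_flat_event R n m l) \<le>
      measure_pmf.prob ?p {X. (1 + \<epsilon>) ^ card (L \<inter> X) \<le> (1 + \<epsilon>) ^ l}"
  proof (intro measure_pmf.finite_measure_mono subsetI)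
    fix X assume "X \<in> - rich_flat_event R n m l"
    then have "card (L \<inter> X) \<le> l"
      using flat by (force simp: rich_flat_event_def is_rich_def)
    then show "X \<in> {X. (1 + \<epsilon>) ^ card (L \<inter> X) \<le> (1 + \<epsilon>) ^ l}"
      using assms(5) by (auto intro: power_increasing)
  qed simp
  moreover have "measure_pmf.prob ?p (- rich_flat_event R n m l) =
      1 - measure_pmf.prob ?p (rich_flat_event R n m l)"
    using measure_pmf.prob_compl[of "rich_flat_event R n m l" ?p] by (simp add: Compl_eq_Diff_UNIV)
  ultimately show ?thesis
    by linarith
qed

section \<open>Passage to the limit along the sequence\<close>

theorem theorem1p5:
  fixes F :: "nat \<Rightarrow> 'a ring"
    and n m q l :: "nat \<Rightarrow> nat"
  assumes "\<And>k. 1 \<le> m k" and "\<And>k. m k < n k"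
    and "\<And>k. primepow (q k)"
    and "\<And>k. Ring.field (F k)" and "\<And>k. card (carrier (F k)) = q k"
    and "filterlim (\<lambda>k. n k + q k) at_top sequentially"
    and "\<And>k. l k \<le> q k ^ m k"
    and "(\<lambda>k. real (l k)) \<in> \<omega>(\<lambda>k. real ((n k - m k) * m k) * ln (real (q k)))"
  shows "\<forall>\<epsilon>>0. \<forall>\<theta> :: nat \<Rightarrow> real. (\<forall>k. 0 \<le> \<theta> k \<and> \<theta> k \<le> 1) \<longrightarrow>
     ((\<forall>\<^sub>F k in sequentially. \<theta> k \<le> (1 - \<epsilon>) * (real (l k) / real (q k) ^ m k)) \<longrightarrow>
        (\<lambda>k. measure_pmf.prob (random_subset (carrier (coord_space (F k) (n k))) (\<theta> k))
               (rich_flat_event (F k) (n k) (m k) (l k))) \<longlonglongrightarrow> 0) \<and>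
     ((\<forall>\<^sub>F k in sequentially. (1 + \<epsilon>) * (real (l k) / real (q k) ^ m k) \<le> \<theta> k) \<longrightarrow>
        (\<lambda>k. measure_pmf.prob (random_subset (carrier (coord_space (F k) (n k))) (\<theta> k))
               (rich_flat_event (F k) (n k) (m k) (l k))) \<longlonglongrightarrow> 1)"
proof (intro allI impI conjI)
  fix \<epsilon> :: real and \<theta> :: "nat \<Rightarrow> real"
  assume \<epsilon>: "0 < \<epsilon>" and \<theta>: "\<forall>k. 0 \<le> \<theta> k \<and> \<theta> k \<le> 1"
  define N where "N = (\<lambda>k. real ((n k - m k) * m k) * ln (real (q k)))"
  have q: "q k \<ge> 2" for k
    using primepow_gt_Suc_0[OF assms(3)[of k]] by simp
  have fin: "finite (carrier (F k))" for k
    using q[of k] assms(5)[of k] by (intro card_ge_0_finite) simp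
  \<comment> \<open>Being bounded away from 0, \<open>N\<close> transfers growth: \<open>l\<close>
    dominating every multiple of \<open>N\<close> tends to infinity.\<close>
  have N: "N k \<ge> ln 2" for k
  proof -
    have "1 * ln 2 \<le> real ((n k - m k) * m k) * ln (real (q k))"
      using assms(1,2)[of k] q[of k]
      by (intro mult_mono) (simp_all add: Suc_le_eq del: of_nat_mult)
    then show ?thesis
      by (simp add: N_def)
  qed
  have lN: "\<forall>\<^sub>F k in sequentially. c * N k \<le> real (l k)" if "c > 0" for c
  proof -
    have "\<forall>\<^sub>F k in sequentially. norm (real (l k)) \<ge> c * norm (N k)"
      using assms(8) that unfolding N_def by (rule landau_omega.smallD)
    then show ?thesis
    proof eventually_elim
      case (elim k)
      have "0 \<le> ln (2 :: real)"
        by simp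
      then show ?case
        using elim order_trans[OF \<open>0 \<le> ln 2\<close> N[of k]] by simp
    qed
  qed
  have l_top: "filterlim (\<lambda>k. real (l k)) at_top sequentially"
    unfolding filterlim_at_top_gt[where c = 0]
  proof (intro allI impI)
    fix Z :: real assume Z: "0 < Z"
    have "\<forall>\<^sub>F k in sequentially. Z / ln 2 * N k \<le> real (l k)"
      using Z by (intro lN) simp
    then show "\<forall>\<^sub>F k in sequentially. Z \<le> real (l k)"
    proof eventually_elim
      case (elim k)
      have "Z / ln 2 * ln 2 \<le> Z / ln 2 * N k"
        using Z N by (intro mult_left_mono) auto
      then show ?case
        using elim by simp
    qed
  qed
  have exp0: "(\<lambda>k. exp (- c * real (l k))) \<longlonglongrightarrow> 0" if "c > 0" for c
  proof -
    have "filterlim (\<lambda>k. - c * real (l k)) at_bot sequentially"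
      using that by (intro filterlim_tendsto_neg_mult_at_bot[OF tendsto_const _ l_top]) simp
    then show ?thesis
      by (rule filterlim_compose[OF exp_at_bot])
  qed
  {
    assume le: "\<forall>\<^sub>F k in sequentially. \<theta> k \<le> (1 - \<epsilon>) * (real (l k) / real (q k) ^ m k)"
    \<comment> \<open>The bound below the threshold requires a deviation less than 1, whereas
      \<epsilon> may be large; shrinking it only weakens the assumption on \<theta>.\<close>
    define d where "d = min \<epsilon> (1 / 2)"
    define c where "c = - d - ln (1 - d)"
    have d: "0 < d" "d < 1" "d \<le> \<epsilon>"
      using \<epsilon> by (auto simp: d_def)
    \<comment> \<open>ln x \<le> x - 1, with equality only at x = 1.\<close>
    have c: "c > 0"
      using ln_le_minus_one[of "1 - d"] ln_eq_minus_one[of "1 - d"] d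
      by (cases "ln (1 - d) = - d") (simp_all add: c_def)
    \<comment> \<open>The constant 10 / c makes 5 N \<le> (c / 2) l: the number of flats, at most
      exp(5 N), uses up only half of the exponent c l.\<close>
    have "\<forall>\<^sub>F k in sequentially. 10 / c * N k \<le> real (l k)"
      using c by (intro lN) simp
    with le have "\<forall>\<^sub>F k in sequentially.
        measure_pmf.prob (random_subset (carrier (coord_space (F k) (n k))) (\<theta> k))
               (rich_flat_event (F k) (n k) (m k) (l k)) \<le> exp (- (c / 2) * real (l k))"
    proof eventually_elim
      case (elim k)
      interpret Ring.field "F k"
        by (rule assms(4))
      have "(1 - \<epsilon>) * (real (l k) / real (q k) ^ m k) \<le> (1 - d) * (real (l k) / real (q k) ^ m k)"
        using d by (intro mult_right_mono) auto
      then have "\<theta> k \<le> (1 - d) * (real (l k) / real (card (carrier (F k))) ^ m k)"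
        using elim(1) by (simp add: assms(5))
      then have "measure_pmf.prob (random_subset (carrier (coord_space (F k) (n k))) (\<theta> k))
          (rich_flat_event (F k) (n k) (m k) (l k)) \<le>
          real (q k) ^ (5 * ((n k - m k) * m k)) * exp (- c * real (l k))"
        using prob_rich_flat_le[OF fin assms(1,2), of "\<theta> k" d "l k"] \<theta> d
        by (simp add: assms(5) c_def)
      also have "real (q k) ^ (5 * ((n k - m k) * m k)) = exp (5 * N k)"
        using q[of k] by (simp add: N_def powr_realpow[symmetric] powr_def)
      also have "exp (5 * N k) * exp (- c * real (l k)) = exp (5 * N k - c * real (l k))"
        by (simp add: exp_add[symmetric])
      also have "\<dots> \<le> exp (- (c / 2) * real (l k))"
        using elim(2) c by (simp add: field_simps)
      finally show ?case .
    qed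
    then show "(\<lambda>k. measure_pmf.prob (random_subset (carrier (coord_space (F k) (n k))) (\<theta> k))
        (rich_flat_event (F k) (n k) (m k) (l k))) \<longlonglongrightarrow> 0"
      using c by (intro tendsto_sandwich[OF _ _ tendsto_const exp0[of "c / 2"]]) auto
  }
  {
    assume ge: "\<forall>\<^sub>F k in sequentially. (1 + \<epsilon>) * (real (l k) / real (q k) ^ m k) \<le> \<theta> k"
    define c where "c = \<epsilon> - ln (1 + \<epsilon>)"
    have c: "c > 0"
      using ln_add_one_self_less_self[OF \<epsilon>] by (simp add: c_def)
    have "\<forall>\<^sub>F k in sequentially. 1 - exp (- c * real (l k)) \<le>
        measure_pmf.prob (random_subset (carrier (coord_space (F k) (n k))) (\<theta> k))
               (rich_flat_event (F k) (n k) (m k) (l k))"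
      using ge
    proof eventually_elim
      case (elim k)
      interpret Ring.field "F k"
        by (rule assms(4))
      show ?case
        using prob_rich_flat_ge[OF fin less_imp_le[OF assms(2)], of "\<theta> k" \<epsilon> "l k"] \<theta> \<epsilon> elim
        by (simp add: assms(5) c_def)
    qed
    moreover have lim: "(\<lambda>k. 1 - exp (- c * real (l k))) \<longlonglongrightarrow> 1"
      using tendsto_diff[OF tendsto_const exp0[OF c], of 1] by simp
    ultimately show
      "(\<lambda>k. measure_pmf.prob (random_subset (carrier (coord_space (F k) (n k))) (\<theta> k))
        (rich_flat_event (F k) (n k) (m k) (l k))) \<longlonglongrightarrow> 1"
      by (intro tendsto_sandwich[OF _ _ lim tendsto_const]) auto
  }
qed

end
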